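(* Let $\Bbbk$ be a field of characteristic zero, let $n, m \geq 1$ be integers, let $V$ be an $n$-dimensional $\Bbbk$-vector space, and let $G$ be a finite permutation group acting naturally on $V$ by permuting a fixed basis of $V$. Let $V^m = V \oplus \cdots \oplus V$ ($m$ copies) with the diagonal action of $G$. Then the top degree of the algebra of coinvariants $\Bbbk[V^m]_G$ is at most $\binom{n}{2}$.
   Context: For a finite group $G$ acting linearly on a finite dimensional $\Bbbk$-vector space $W$, $\Bbbk[W]$ denotes the symmetric algebra on $W^*$ (a polynomial ring with its standard grading), on which $G$ acts by $(gf)(v) = f(g^{-1}v)$ for $g \in G$, $f \in \Bbbk[W]$, $v \in W$. $\Bbbk[W]^G$ is the graded subalgebra of $G$-invariant polynomials. The Hilbert ideal $I(G,W) = \Bbbk[W]^G_+\,\Bbbk[W]$ is the ideal of $\Bbbk[W]$ generated by all invariants of positive degree. The algebra of coinvariants is the graded quotient ring $\Bbbk[W]_G = \Bbbk[W]/I(G,W)$; it is finite dimensional over $\Bbbk$, and its top degree is the highest degree in which it is non-zero. *)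

theory Defs
  imports
    "HOL-Analysis.Cartesian_Space"
    "HOL-Library.Poly_Mapping"
    "HOL-Algebra.Bij"
    "HOL-Algebra.QuotRing"
    "HOL-Algebra.Algebraic_Closure_Type"
begin

text \<open>
  Coordinate form of \<open>\<Bbbk>[W]\<close> for \<open>W = \<Bbbk>\<^sup>I\<close> with a finite index type \<open>I\<close>:
  the symmetric algebra on the dual space is the polynomial ring in the coordinate functions
  \<open>x\<^sub>i\<close> (\<open>i \<in> I\<close>), i.e. the monoid algebra over \<open>\<Bbbk>\<close> of the exponent
  vectors \<open>I \<Rightarrow>\<^sub>0 nat\<close>, with the convolution product of \<^theory>\<open>HOL-Library.Poly_Mapping\<close>.
\<close>

type_synonym ('i, 'k) mpoly = "('i \<Rightarrow>\<^sub>0 nat) \<Rightarrow>\<^sub>0 'k"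

definition mconst :: "'k::comm_ring_1 \<Rightarrow> ('i, 'k) mpoly" where
  "mconst c = Poly_Mapping.single 0 c"

definition mvar :: "'i \<Rightarrow> ('i, 'k::comm_ring_1) mpoly" where
  "mvar i = Poly_Mapping.single (Poly_Mapping.single i 1) 1"

definition mdegree :: "('i::finite \<Rightarrow>\<^sub>0 nat) \<Rightarrow> nat" where
  "mdegree a = (\<Sum>i\<in>UNIV. Poly_Mapping.lookup a i)"

definition homogeneous :: "nat \<Rightarrow> ('i::finite, 'k::comm_ring_1) mpoly set" where
  "homogeneous d = {f. \<forall>a\<in>Poly_Mapping.keys f. mdegree a = d}"

definition msubst ::
  "('k::comm_ring_1 \<Rightarrow> 'b::comm_ring_1) \<Rightarrow> ('i::finite \<Rightarrow> 'b) \<Rightarrow> ('i, 'k) mpoly \<Rightarrow> 'b" where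
  "msubst h s f =
     (\<Sum>a\<in>Poly_Mapping.keys f.
        h (Poly_Mapping.lookup f a) * (\<Prod>i\<in>UNIV. s i ^ Poly_Mapping.lookup a i))"

definition meval :: "('i::finite, 'k::comm_ring_1) mpoly \<Rightarrow> 'k ^ 'i \<Rightarrow> 'k" where
  "meval f v = msubst (\<lambda>c. c) (\<lambda>i. v $ i) f"

text \<open>
  The polynomial \<open>f \<circ> L\<close> for a linear map \<open>L\<close>: each variable \<open>x\<^sub>i\<close> is replaced
  by the linear form \<open>x\<^sub>i \<circ> L\<close>.  Lemma \<open>meval_pullback\<close> below confirms this.
\<close>

definition pullback ::
  "('k::field ^ 'i \<Rightarrow> 'k ^ 'i) \<Rightarrow> ('i::finite, 'k) mpoly \<Rightarrow> ('i, 'k) mpoly" where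
  "pullback L f = msubst mconst (\<lambda>i. \<Sum>j\<in>UNIV. mconst (matrix L $ i $ j) * mvar j) f"

text \<open>
  A linear action of \<open>G\<close> on \<open>W\<close> is given by a map \<open>\<rho>\<close> assigning to each
  \<open>g \<in> G\<close> a linear automorphism of \<open>W\<close>; the action of the group inverse of \<open>g\<close> is then
  the inverse map of \<open>\<rho> g\<close>, so that \<open>(g f)(v) = f(g\<^sup>-\<^sup>1 v)\<close>.
\<close>

definition poly_action ::
  "('g \<Rightarrow> 'k::field ^ 'i \<Rightarrow> 'k ^ 'i) \<Rightarrow> 'g \<Rightarrow> ('i::finite, 'k) mpoly \<Rightarrow> ('i, 'k) mpoly" where
  "poly_action \<rho> g f = pullback (inv_into UNIV (\<rho> g)) f"

definition invariants ::
  "'g set \<Rightarrow> ('g \<Rightarrow> 'k::field ^ 'i \<Rightarrow> 'k ^ 'i) \<Rightarrow> ('i::finite, 'k) mpoly set" where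
  "invariants G \<rho> = {f. \<forall>g\<in>G. poly_action \<rho> g f = f}"

text \<open>
  The graded algebra \<open>\<Bbbk>[W]\<^sup>G\<close> has \<open>\<Bbbk>[W]\<^sup>G\<^sub>+\<close> as the sum of its components of positive
  degree, so the Hilbert ideal is generated by the homogeneous invariants of positive degree.
  (Non-homogeneous invariants with a non-zero constant term must not be included.)
\<close>

definition hilbert_ideal ::
  "'g set \<Rightarrow> ('g \<Rightarrow> 'k::field ^ 'i \<Rightarrow> 'k ^ 'i) \<Rightarrow> ('i::finite, 'k) mpoly set" where
  "hilbert_ideal G \<rho> =
     Idl\<^bsub>ring_of_type_algebra\<^esub> (\<Union>d\<in>{1..}. invariants G \<rho> \<inter> homogeneous d)"

definition coinvariants ::
  "'g set \<Rightarrow> ('g \<Rightarrow> 'k::field ^ 'i \<Rightarrow> 'k ^ 'i) \<Rightarrow> ('i::finite, 'k) mpoly set ring" where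
  "coinvariants G \<rho> = ring_of_type_algebra Quot hilbert_ideal G \<rho>"

definition coinvariants_component ::
  "'g set \<Rightarrow> ('g \<Rightarrow> 'k::field ^ 'i \<Rightarrow> 'k ^ 'i) \<Rightarrow> nat \<Rightarrow> ('i::finite, 'k) mpoly set set" where
  "coinvariants_component G \<rho> d =
     (\<lambda>f. hilbert_ideal G \<rho> +>\<^bsub>ring_of_type_algebra\<^esub> f) ` homogeneous d"

text \<open>
  \<^const>\<open>Max\<close> is specified only on finite non-empty sets.  The set below is finite since the algebra
  of coinvariants of a finite group is finite dimensional, and it contains \<open>0\<close> since all
  generators of the Hilbert ideal have zero constant term.
\<close>

definition coinvariants_top_degree ::
  "'g set \<Rightarrow> ('g \<Rightarrow> 'k::field ^ 'i::finite \<Rightarrow> 'k ^ 'i) \<Rightarrow> nat" where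
  "coinvariants_top_degree G \<rho> =
     Max {d. coinvariants_component G \<rho> d \<noteq> {\<zero>\<^bsub>coinvariants G \<rho>\<^esub>}}"

text \<open>
  The permutation action on \<open>V = \<Bbbk>\<^sup>n\<close>, written in the permuted basis: \<open>g\<close> sends the basis vector
  \<open>e\<^sub>i\<close> to the basis vector with index \<open>g i\<close>, hence moves the \<open>i\<close>-th coordinate
  to position \<open>g i\<close>.
\<close>

definition perm_action :: "('n \<Rightarrow> 'n) \<Rightarrow> 'k::field ^ 'n::finite \<Rightarrow> 'k ^ 'n" where
  "perm_action g v = (\<chi> i. v $ (inv_into UNIV g i))"

text \<open>
  \<open>V\<^sup>m\<close> has coordinates indexed by pairs: the entry at \<open>(j, i)\<close> is the \<open>i\<close>-th coordinate of the
  \<open>j\<close>-th copy of \<open>V\<close>.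
\<close>

definition copy :: "'m::finite \<Rightarrow> 'k ^ ('m \<times> 'n::finite) \<Rightarrow> 'k ^ 'n" where
  "copy j v = (\<chi> i. v $ (j, i))"

definition diagonal_action ::
  "('g \<Rightarrow> 'k ^ 'n \<Rightarrow> 'k ^ 'n) \<Rightarrow> 'g \<Rightarrow> 'k ^ ('m::finite \<times> 'n::finite) \<Rightarrow> 'k ^ ('m \<times> 'n)" where
  "diagonal_action \<rho> g v = (\<chi> p. \<rho> g (copy (fst p) v) $ snd p)"

lemma copy_diagonal_action: "copy j (diagonal_action \<rho> g v) = \<rho> g (copy j v)"
  by (simp add: copy_def diagonal_action_def vec_eq_iff)

lemma perm_action_axis:
  assumes "bij g"
  shows "perm_action g (axis i 1) = axis (g i) 1"
  using assms by (auto simp: perm_action_def axis_def vec_eq_iff bij_def surj_f_inv_f)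

lemma perm_action_comp:
  assumes "bij g" "bij h"
  shows "perm_action (g \<circ> h) v = perm_action g (perm_action h v)"
  using assms by (simp add: perm_action_def vec_eq_iff o_inv_distrib)

lemma linear_diagonal_perm_action:
  "Vector_Spaces.linear (*s) (*s) (diagonal_action perm_action g)"
  by unfold_locales
    (auto simp: diagonal_action_def perm_action_def copy_def vec_eq_iff algebra_simps)

lemma meval_superset:
  assumes "finite A" "Poly_Mapping.keys f \<subseteq> A"
  shows "meval f v =
    (\<Sum>a\<in>A. Poly_Mapping.lookup f a * (\<Prod>i\<in>UNIV. (v $ i) ^ Poly_Mapping.lookup a i))"
  unfolding meval_def msubst_def
  by (rule sum.mono_neutral_left) (use assms in \<open>auto simp: in_keys_iff\<close>)

lemma meval_zero: "meval 0 v = 0"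
  by (simp add: meval_def msubst_def)

lemma meval_add: "meval (f + g) v = meval f v + meval g v"
  using Poly_Mapping.keys_add[of f g]
  by (simp add: meval_superset[of "Poly_Mapping.keys f \<union> Poly_Mapping.keys g"]
      lookup_add algebra_simps sum.distrib)

lemma meval_single:
  "meval (Poly_Mapping.single a c) v = c * (\<Prod>i\<in>UNIV. (v $ i) ^ Poly_Mapping.lookup a i)"
  by (subst meval_superset[of "{a}"]) auto

lemma meval_mconst: "meval (mconst c) v = c"
  by (simp add: mconst_def meval_single)

lemma meval_mvar: "meval (mvar i) v = v $ i"
proof -
  have "(\<Prod>j\<in>UNIV. (v $ j) ^ Poly_Mapping.lookup (Poly_Mapping.single i (1::nat)) j) =
      (\<Prod>j\<in>UNIV. if j = i then v $ j else 1)"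
    by (rule prod.cong) (auto simp: lookup_single when_def)
  then show ?thesis by (simp add: mvar_def meval_single)
qed

lemma meval_sum: "meval (\<Sum>x\<in>A. F x) v = (\<Sum>x\<in>A. meval (F x) v)"
  by (induction A rule: infinite_finite_induct) (simp_all add: meval_zero meval_add)

lemma mpoly_eq_sum_single:
  "f = (\<Sum>a\<in>Poly_Mapping.keys f. Poly_Mapping.single a (Poly_Mapping.lookup f a))"
  by (rule poly_mapping_eqI)
    (auto simp: lookup_sum lookup_single when_def in_keys_iff sum.delta)

lemma meval_mult: "meval (f * g) v = meval f v * meval g v"
proof -
  have *: "meval (Poly_Mapping.single a c * Poly_Mapping.single b d) v =
      meval (Poly_Mapping.single a c) v * meval (Poly_Mapping.single b d) v" for a b c d
    by (simp add: mult_single meval_single lookup_add power_add prod.distrib algebra_simps)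
  show ?thesis
    by (subst (1 2) mpoly_eq_sum_single[of f], subst (1 2) mpoly_eq_sum_single[of g])
      (simp only: sum_product meval_sum *)
qed

lemma meval_one: "meval 1 v = 1"
  using meval_mconst[of 1 v] by (simp add: mconst_def)

lemma meval_prod: "meval (\<Prod>x\<in>A. F x) v = (\<Prod>x\<in>A. meval (F x) v)"
  by (induction A rule: infinite_finite_induct) (simp_all add: meval_one meval_mult)

lemma meval_power: "meval (f ^ n) v = meval f v ^ n"
  by (induction n) (simp_all add: meval_one meval_mult)

lemma meval_pullback:
  assumes "Vector_Spaces.linear (*s) (*s) L"
  shows "meval (pullback L f) v = meval f (L v)"
proof -
  have "(\<Sum>j\<in>UNIV. matrix L $ i $ j * v $ j) = L v $ i" for i
    using matrix_works[OF assms, of v] by (simp add: matrix_vector_mult_def vec_eq_iff)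
  then show ?thesis
    by (simp add: pullback_def msubst_def meval_sum meval_mult meval_prod meval_power
        meval_mconst meval_mvar meval_def[of f])
qed

end

theory Submission
  imports Defs
begin

text \<open>
  Write \<open>x\<^bsub>j,p\<^esub>\<close> for the coordinate at the point \<open>p\<close> in the copy \<open>j\<close> of \<open>V\<close>, and \<open>n\<close> for the
  number of points.  A polynomial that is symmetric under all permutations of the points is
  \<open>G\<close>-invariant, so the symmetric ones of positive degree lie in the Hilbert ideal \<open>I\<close>.  The ones
  that matter are the polarized elementary symmetric polynomials
  \<open>E(y\<^sub>1 \<dots> y\<^sub>l, K)\<close>, taken at \<open>K = UNIV\<close>: the sum, over all injections \<open>p\<close> of the index set
  \<open>{1..l}\<close> into the set of points \<open>K\<close>, of the product of the variables at \<open>(y\<^sub>i, p\<^sub>i)\<close>.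

  The heart of the proof is a many-variable form of the fact that \<open>N\<close> numbers whose elementary
  symmetric functions all vanish have vanishing \<open>N\<close>-th powers.  Let \<open>K\<close> have \<open>N\<close> elements and work
  modulo \<open>I\<close> and the variables at points outside \<open>K\<close>, where all \<open>E(ys, K)\<close> with nonempty \<open>ys\<close>
  vanish.  Splitting the injections by which index, if any, hits a given point \<open>k\<close> of \<open>K\<close>
  (\<open>polarized_esym_insert\<close>) gives, by induction on the length \<open>l\<close> of \<open>ys\<close>,
  \<open>E(ys, K - {k}) \<equiv> (-1)\<^sup>l l! u\<close> with \<open>u\<close> the product of the \<open>x\<^bsub>y,k\<^esub>\<close> over the entries \<open>y\<close>
  of \<open>ys\<close> (\<open>polarized_esym_congruence\<close>).  For \<open>l = N\<close> there is no injection into \<open>K - {k}\<close>, so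
  the left side is zero, and in characteristic zero \<open>u\<close> itself is congruent to \<open>0\<close>
  (\<open>power_at_point\<close>).

  Number the points \<open>0, \<dots>, n - 1\<close> and let \<open>K\<close> be the set of points from number \<open>i\<close> on.
  Then a monomial with degree at least \<open>n - i\<close> in the variables at the point \<open>i\<close> can be rewritten
  modulo \<open>I\<close> into monomials of the same total degree that are shifted towards earlier points.
  This cannot go on forever.  A monomial that cannot be rewritten has degree at most
  \<open>n - 1 - i\<close> at each point \<open>i\<close>, hence total degree at most \<open>n choose 2\<close>; so every monomial of
  larger degree lies in \<open>I\<close> (\<open>monomial_in_ideal\<close>).
\<close>

section \<open>Ideals and substitution homomorphisms\<close>

lemma
  assumes "ideal I (ring_of_type_algebra :: 'a::comm_ring_1 ring)"
  shows ideal_0: "0 \<in> I"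
    and ideal_add: "a \<in> I \<Longrightarrow> b \<in> I \<Longrightarrow> a + b \<in> I"
    and ideal_mult: "a \<in> I \<Longrightarrow> r * a \<in> I"
proof -
  interpret ideal I "ring_of_type_algebra :: 'a ring" by fact
  show "0 \<in> I" using additive_subgroup.zero_closed[OF is_additive_subgroup] by (simp add: ring_of_type_algebra_def)
  show "a \<in> I \<Longrightarrow> b \<in> I \<Longrightarrow> a + b \<in> I"
    using additive_subgroup.a_closed[OF is_additive_subgroup, of a b] by (simp add: ring_of_type_algebra_def)
  show "a \<in> I \<Longrightarrow> r * a \<in> I"
    using I_l_closed[of a r] by (simp add: ring_of_type_algebra_def)
qed

lemma ideal_sum:
  assumes "ideal I (ring_of_type_algebra :: 'a::comm_ring_1 ring)" "\<And>x. x \<in> A \<Longrightarrow> F x \<in> I"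
  shows "sum F A \<in> I"
  using assms(2) ideal_0[OF assms(1)] ideal_add[OF assms(1)]
  by (induction A rule: infinite_finite_induct) auto

lemma msubst_superset:
  assumes "finite A" "Poly_Mapping.keys f \<subseteq> A" "h 0 = 0"
  shows "msubst h s f =
    (\<Sum>a\<in>A. h (Poly_Mapping.lookup f a) * (\<Prod>i\<in>UNIV. s i ^ Poly_Mapping.lookup a i))"
  unfolding msubst_def
  by (rule sum.mono_neutral_left) (use assms in \<open>auto simp: in_keys_iff\<close>)

lemma mconst_0: "mconst 0 = 0"
  and mconst_1: "mconst 1 = 1"
  and mconst_add: "mconst (a + b) = mconst a + mconst b"
  and mconst_uminus: "mconst (- a) = - mconst a"
  and mconst_mult: "mconst (a * b) = mconst a * mconst b"
  by (simp_all add: mconst_def single_add single_uminus mult_single)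

lemma msubst_add: "msubst mconst s (f + g) = msubst mconst s f + msubst mconst s g"
  using Poly_Mapping.keys_add[of f g]
  by (simp add: msubst_superset[of "Poly_Mapping.keys f \<union> Poly_Mapping.keys g"] mconst_0 mconst_add
      lookup_add algebra_simps sum.distrib)

lemma msubst_0: "msubst mconst s 0 = 0"
  by (simp add: msubst_def)

lemma msubst_sum: "msubst mconst s (sum F A) = (\<Sum>x\<in>A. msubst mconst s (F x))"
  by (induction A rule: infinite_finite_induct) (simp_all add: msubst_0 msubst_add)

lemma msubst_single:
  "msubst mconst s (Poly_Mapping.single a c) = mconst c * (\<Prod>i\<in>UNIV. s i ^ Poly_Mapping.lookup a i)"
  by (subst msubst_superset[of "{a}"]) (auto simp: mconst_0)

lemma msubst_mult: "msubst mconst s (f * g) = msubst mconst s f * msubst mconst s g"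
proof -
  have *: "msubst mconst s (Poly_Mapping.single a c * Poly_Mapping.single b d) =
      msubst mconst s (Poly_Mapping.single a c) * msubst mconst s (Poly_Mapping.single b d)" for a b c d
    by (simp add: mult_single msubst_single lookup_add power_add prod.distrib mconst_mult algebra_simps)
  show ?thesis
    by (subst (1 2) mpoly_eq_sum_single[of f], subst (1 2) mpoly_eq_sum_single[of g])
      (simp only: sum_product msubst_sum *)
qed

lemma msubst_1: "msubst mconst s 1 = 1"
  using msubst_single[of s 0 1] by (simp add: mconst_1)

lemma msubst_mvar: "msubst mconst s (mvar i) = s i"
proof -
  have "(\<Prod>j\<in>UNIV. s j ^ Poly_Mapping.lookup (Poly_Mapping.single i (1::nat)) j) =
      (\<Prod>j\<in>UNIV. if j = i then s j else 1)"
    by (rule prod.cong) (auto simp: lookup_single when_def)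
  then show ?thesis by (simp add: mvar_def msubst_single mconst_1)
qed

text \<open>
  The coordinate \<open>x\<^bsub>j,p\<^esub>\<close> goes to \<open>x\<^bsub>j,g p\<^esub>\<close>: the inverse in the action on polynomials cancels the one
  in \<^const>\<open>perm_action\<close>.
\<close>

lemma poly_action_diagonal_perm_action:
  fixes g :: "'n::finite \<Rightarrow> 'n" and f :: "('m::finite \<times> 'n, 'k::field) mpoly"
  assumes "bij g"
  shows "poly_action (diagonal_action perm_action) g f =
    msubst mconst (\<lambda>p. mvar (fst p, g (snd p))) f"
proof -
  have *: "diagonal_action perm_action g v = (\<chi> p. v $ (fst p, inv_into UNIV g (snd p)))"
    for v :: "'k ^ ('m \<times> 'n)"
    by (simp add: diagonal_action_def perm_action_def copy_def)
  have inv: "inv_into UNIV (diagonal_action perm_action g) = (\<lambda>v :: 'k ^ ('m \<times> 'n). \<chi> p. v $ (fst p, g (snd p)))"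
    using assms by (intro inv_equality) (auto simp: * vec_eq_iff bij_is_inj bij_is_surj surj_f_inv_f)
  have "(\<Sum>q\<in>UNIV. mconst (matrix (\<lambda>v :: 'k ^ ('m \<times> 'n). \<chi> p. v $ (fst p, g (snd p))) $ p $ q) * mvar q)
      = (\<Sum>q\<in>UNIV. if q = (fst p, g (snd p)) then mvar q else 0)" for p
    by (rule sum.cong) (auto simp: matrix_def axis_def mconst_0 mconst_1)
  then show ?thesis
    by (simp add: poly_action_def pullback_def inv)
qed

section \<open>Polarized elementary symmetric polynomials\<close>

text \<open>
  The recursion chooses the image of the first index and forbids it to the others, so the sum runs
  over injections.  If all entries of \<open>ys\<close> are equal to \<open>y\<close>, this is \<open>length ys\<close> factorial times
  an elementary symmetric polynomial in the variables at \<open>(y, p)\<close>, \<open>p \<in> K\<close>.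
\<close>

fun polarized_esym :: "'m list \<Rightarrow> 'n set \<Rightarrow> ('m \<times> 'n, 'k::comm_ring_1) mpoly" where
  "polarized_esym [] K = 1"
| "polarized_esym (y # ys) K = (\<Sum>p\<in>K. mvar (y, p) * polarized_esym ys (K - {p}))"

lemma msubst_polarized_esym:
  assumes "inj g"
  shows "msubst mconst (\<lambda>p. mvar (fst p, g (snd p))) (polarized_esym ys K :: ('m::finite \<times> 'n::finite, 'k::comm_ring_1) mpoly)
    = polarized_esym ys (g ` K)"
proof (induction ys arbitrary: K)
  case Nil
  then show ?case by (simp add: msubst_1)
next
  case (Cons y ys)
  have "g ` K - {g p} = g ` (K - {p})" for p
    using assms by (auto dest: injD)
  then show ?case
    using assms by (simp add: msubst_sum msubst_mult msubst_mvar Cons sum.reindex inj_on_subset[OF assms])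
qed

lemma mdegree_add: "mdegree (a + b) = mdegree a + mdegree b"
  by (simp add: mdegree_def lookup_add sum.distrib)

lemma mdegree_single: "mdegree (Poly_Mapping.single i c) = c"
  by (simp add: mdegree_def lookup_single when_def)

lemma homogeneous_sum: "(\<And>x. x \<in> A \<Longrightarrow> F x \<in> homogeneous d) \<Longrightarrow> sum F A \<in> homogeneous d"
  using keys_sum[of F A] unfolding homogeneous_def by blast

lemma keys_mvar_mult:
  assumes "a \<in> Poly_Mapping.keys (mvar i * f)"
  obtains b where "b \<in> Poly_Mapping.keys f" "a = Poly_Mapping.single i 1 + b"
proof -
  have "Poly_Mapping.keys (mvar i) \<subseteq> {Poly_Mapping.single i 1}"
    by (simp add: mvar_def)
  then show ?thesis
    using keys_mult[of "mvar i" f] assms that by blast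
qed

lemma homogeneous_mvar_mult: "f \<in> homogeneous d \<Longrightarrow> mvar i * f \<in> homogeneous (Suc d)"
  unfolding homogeneous_def by (auto elim!: keys_mvar_mult simp: mdegree_add mdegree_single)

lemma homogeneous_polarized_esym: "polarized_esym ys K \<in> homogeneous (length ys)"
proof (induction ys arbitrary: K)
  case Nil
  then show ?case by (simp add: homogeneous_def mdegree_def)
next
  case (Cons y ys)
  then show ?case by (simp add: homogeneous_sum homogeneous_mvar_mult)
qed

definition remove_nth :: "nat \<Rightarrow> 'a list \<Rightarrow> 'a list" where
  "remove_nth i xs = take i xs @ drop (Suc i) xs"

text \<open>
  An injection into \<open>insert k K\<close> either misses \<open>k\<close> or sends exactly one index \<open>i\<close> there.
\<close>

lemma polarized_esym_insert:
  fixes K :: "'n set" and ys :: "'m list"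
  assumes "finite K" "k \<notin> K"
  shows "(polarized_esym ys (insert k K) :: ('m \<times> 'n, 'k::comm_ring_1) mpoly) =
    polarized_esym ys K + (\<Sum>i<length ys. mvar (ys ! i, k) * polarized_esym (remove_nth i ys) K)"
  using assms
proof (induction ys arbitrary: K)
  case Nil
  then show ?case by simp
next
  case (Cons y ys)
  let ?S = "\<lambda>K. \<Sum>i<length ys. mvar (ys ! i, k) * polarized_esym (remove_nth i ys) K :: ('m \<times> 'n, 'k) mpoly"
  have eq: "insert k K - {p} = insert k (K - {p})" if "p \<in> K" for p
    using that Cons.prems by auto
  have "(polarized_esym (y # ys) (insert k K) :: ('m \<times> 'n, 'k) mpoly) = mvar (y, k) * polarized_esym ys K +
      (\<Sum>p\<in>K. mvar (y, p) * polarized_esym ys (insert k K - {p}))"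
    using Cons.prems by simp
  also have "(\<Sum>p\<in>K. mvar (y, p) * polarized_esym ys (insert k K - {p})) =
      (\<Sum>p\<in>K. mvar (y, p) * (polarized_esym ys (K - {p}) + ?S (K - {p})))"
    using Cons.prems by (intro sum.cong refl) (simp add: eq Cons.IH)
  also have "\<dots> = polarized_esym (y # ys) K + (\<Sum>p\<in>K. mvar (y, p) * ?S (K - {p}))"
    by (simp add: algebra_simps sum.distrib)
  also have "(\<Sum>p\<in>K. mvar (y, p) * ?S (K - {p})) =
      (\<Sum>i<length ys. mvar (ys ! i, k) * polarized_esym (y # remove_nth i ys) K)"
    by (simp add: sum_distrib_left, subst sum.swap) (simp add: algebra_simps)
  \<comment> \<open>The first index gives the term for \<open>i = 0\<close>, the others are shifted by one.\<close>
  finally show ?case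
    by (simp only: length_Cons sum.lessThan_Suc_shift)
      (simp add: remove_nth_def algebra_simps)
qed

lemma polarized_esym_eq_0:
  fixes K :: "'n set" and ys :: "'m list"
  assumes "finite K" "length ys > card K"
  shows "polarized_esym ys K = (0 :: ('m \<times> 'n, 'k::comm_ring_1) mpoly)"
  using assms
proof (induction ys arbitrary: K)
  case Nil
  then show ?case by simp
next
  case (Cons y ys)
  have "polarized_esym ys (K - {p}) = (0 :: ('m \<times> 'n, 'k) mpoly)" if "p \<in> K" for p
    using that Cons.prems Cons.IH[of "K - {p}"] card_Suc_Diff1[of K p] by simp
  then show ?case by simp
qed

section \<open>Rewriting a power at one point\<close>

text \<open>
  This is the component of degree \<open>d\<close> of the ideal generated by the variables in \<open>P\<close>.  It is
  described by monomials because the rewriting of monomials in the end has to read off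
  which exponents occur.
\<close>

definition touching :: "'i set \<Rightarrow> nat \<Rightarrow> ('i::finite, 'k::comm_ring_1) mpoly set" where
  "touching P d = homogeneous d \<inter> {f. \<forall>a\<in>Poly_Mapping.keys f. Poly_Mapping.keys a \<inter> P \<noteq> {}}"

lemma touching_add: "f \<in> touching P d \<Longrightarrow> g \<in> touching P d \<Longrightarrow> f + g \<in> touching P d"
  using keys_add[of f g] unfolding touching_def homogeneous_def by blast

lemma touching_sum: "(\<And>x. x \<in> A \<Longrightarrow> F x \<in> touching P d) \<Longrightarrow> sum F A \<in> touching P d"
  using keys_sum[of F A] unfolding touching_def homogeneous_def by blast

lemma keys_add_nat: "Poly_Mapping.keys (a + b) = Poly_Mapping.keys a \<union> Poly_Mapping.keys (b :: 'i \<Rightarrow>\<^sub>0 nat)"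
  by (auto simp: in_keys_iff lookup_add)

lemma touching_mconst_mult:
  assumes "f \<in> touching P d" shows "mconst c * f \<in> touching P d"
proof -
  have "Poly_Mapping.keys (mconst c) \<subseteq> {0}" by (simp add: mconst_def)
  then have "Poly_Mapping.keys (mconst c * f) \<subseteq> Poly_Mapping.keys f"
    using keys_mult[of "mconst c" f] by force
  then show ?thesis
    using assms unfolding touching_def homogeneous_def by blast
qed

lemma touching_mvar_mult: "f \<in> touching P d \<Longrightarrow> mvar i * f \<in> touching P (Suc d)"
  by (auto simp: touching_def homogeneous_mvar_mult keys_add_nat elim!: keys_mvar_mult)

lemma mvar_mult_touching: "f \<in> homogeneous d \<Longrightarrow> i \<in> P \<Longrightarrow> mvar i * f \<in> touching P (Suc d)"
  by (auto simp: touching_def homogeneous_mvar_mult keys_add_nat elim!: keys_mvar_mult)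

text \<open>The injections into \<open>L\<close> that do not stay inside \<open>K\<close> use a variable at a point of \<open>L - K\<close>.\<close>

lemma polarized_esym_superset:
  fixes K L :: "'n::finite set"
  assumes "K \<subseteq> L"
  shows "(polarized_esym ys L - polarized_esym ys K :: ('m::finite \<times> 'n, 'k::comm_ring_1) mpoly) \<in> touching (UNIV \<times> (L - K)) (length ys)"
  using assms
proof (induction ys arbitrary: K L)
  case Nil
  then show ?case by (simp add: touching_def homogeneous_def)
next
  case (Cons y ys)
  have "(polarized_esym (y # ys) L :: ('m \<times> 'n, 'k) mpoly) = (\<Sum>p\<in>K. mvar (y, p) * polarized_esym ys (L - {p})) +
      (\<Sum>p\<in>L - K. mvar (y, p) * polarized_esym ys (L - {p}))"
    using Cons.prems by (simp add: sum.subset_diff[of K L] add.commute)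
  then have eq: "(polarized_esym (y # ys) L - polarized_esym (y # ys) K :: ('m \<times> 'n, 'k) mpoly) =
      (\<Sum>p\<in>K. mvar (y, p) * (polarized_esym ys (L - {p}) - polarized_esym ys (K - {p}))) +
      (\<Sum>p\<in>L - K. mvar (y, p) * polarized_esym ys (L - {p}))"
    by (simp add: algebra_simps sum_subtractf)
  have "(mvar (y, p) * (polarized_esym ys (L - {p}) - polarized_esym ys (K - {p})) :: ('m \<times> 'n, 'k) mpoly) \<in> touching (UNIV \<times> (L - K)) (Suc (length ys))"
    if "p \<in> K" for p
  proof -
    have "L - {p} - (K - {p}) = L - K" using that by auto
    then show ?thesis
      using Cons.IH[of "K - {p}" "L - {p}"] Cons.prems by (metis touching_mvar_mult Diff_mono order_refl)
  qed
  moreover have "(mvar (y, p) * polarized_esym ys (L - {p}) :: ('m \<times> 'n, 'k) mpoly) \<in> touching (UNIV \<times> (L - K)) (Suc (length ys))"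
    if "p \<in> L - K" for p
    by (rule mvar_mult_touching[OF homogeneous_polarized_esym]) (use that in simp)
  ultimately show ?case
    unfolding eq length_Cons by (intro touching_add touching_sum)
qed

text \<open>
  Membership in \<open>graded_sum I P d\<close> is the congruence to \<open>0\<close> modulo \<open>I\<close> and the variables in \<open>P\<close>,
  with the degree of the second part recorded.  The record is needed because rewriting has to
  preserve the total degree of monomials, while \<open>I\<close> is an arbitrary ideal here.
\<close>

definition graded_sum :: "('i::finite, 'k::comm_ring_1) mpoly set \<Rightarrow> 'i set \<Rightarrow> nat \<Rightarrow> ('i, 'k) mpoly set" where
  "graded_sum I P d = {f + g | f g. f \<in> I \<and> g \<in> touching P d}"

context
  fixes I :: "('i::finite, 'k::comm_ring_1) mpoly set"
  assumes I: "ideal I ring_of_type_algebra"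
begin

lemma graded_sumI: "f \<in> I \<Longrightarrow> g \<in> touching P d \<Longrightarrow> f + g \<in> graded_sum I P d"
  unfolding graded_sum_def by blast

lemma graded_sum_add:
  assumes "f \<in> graded_sum I P d" "g \<in> graded_sum I P d"
  shows "f + g \<in> graded_sum I P d"
proof -
  obtain a b where f: "f = a + b" "a \<in> I" "b \<in> touching P d"
    using assms(1) unfolding graded_sum_def by blast
  obtain c e where g: "g = c + e" "c \<in> I" "e \<in> touching P d"
    using assms(2) unfolding graded_sum_def by blast
  have "(a + c) + (b + e) \<in> graded_sum I P d"
    by (intro graded_sumI ideal_add[OF I] touching_add f g)
  then show ?thesis by (simp add: f g algebra_simps)
qed

lemma graded_sum_mconst_mult:
  assumes "f \<in> graded_sum I P d" shows "mconst c * f \<in> graded_sum I P d"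
proof -
  obtain a b where f: "f = a + b" "a \<in> I" "b \<in> touching P d"
    using assms unfolding graded_sum_def by blast
  show ?thesis
    unfolding f(1) distrib_left by (intro graded_sumI ideal_mult[OF I] touching_mconst_mult f)
qed

lemma graded_sum_mvar_mult:
  assumes "f \<in> graded_sum I P d" shows "mvar i * f \<in> graded_sum I P (Suc d)"
proof -
  obtain a b where f: "f = a + b" "a \<in> I" "b \<in> touching P d"
    using assms unfolding graded_sum_def by blast
  show ?thesis
    unfolding f(1) distrib_left by (intro graded_sumI ideal_mult[OF I] touching_mvar_mult f)
qed

lemma graded_sum_uminus: "f \<in> graded_sum I P d \<Longrightarrow> - f \<in> graded_sum I P d"
  using graded_sum_mconst_mult[of f P d "-1"] by (simp add: mconst_uminus mconst_1)

lemma graded_sum_diff: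
  "f \<in> graded_sum I P d \<Longrightarrow> g \<in> graded_sum I P d \<Longrightarrow> f - g \<in> graded_sum I P d"
  using graded_sum_add[of f P d "- g"] graded_sum_uminus by simp

lemma graded_sum_0: "0 \<in> graded_sum I P d"
  using ideal_0[OF I] unfolding graded_sum_def
  by (intro CollectI exI[of _ 0]) (auto simp: touching_def homogeneous_def)

lemma graded_sum_sum: "(\<And>x. x \<in> A \<Longrightarrow> F x \<in> graded_sum I P d) \<Longrightarrow> sum F A \<in> graded_sum I P d"
  by (induction A rule: infinite_finite_induct) (auto simp: graded_sum_0 graded_sum_add)

end

lemma prod_list_remove_nth:
  fixes f :: "'a \<Rightarrow> 'b::comm_monoid_mult"
  assumes "i < length ys"
  shows "f (ys ! i) * prod_list (map f (remove_nth i ys)) = prod_list (map f ys)"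
  by (subst (3) id_take_nth_drop[OF assms]) (simp add: remove_nth_def algebra_simps)

text \<open>
  Modulo the variables outside \<open>K\<close>, the hypothesis on \<open>I\<close> passes from \<open>UNIV\<close> to \<open>K\<close>.  Solving
  \<open>polarized_esym_insert\<close> for the sum over \<open>K - {k}\<close> then expresses it by \<open>length ys\<close> sums with
  one index less, each of which contributes the same multiple of the monomial at \<open>k\<close>: hence
  the sign and the factorial.
\<close>

lemma polarized_esym_congruence:
  fixes I :: "('m::finite \<times> 'n::finite, 'k::{comm_ring_1,semiring_char_0}) mpoly set"
  assumes I: "ideal I ring_of_type_algebra"
    and E: "\<And>ys. ys \<noteq> [] \<Longrightarrow> polarized_esym ys UNIV \<in> I"
    and k: "k \<in> K"
  shows "polarized_esym ys (K - {k}) - mconst ((-1) ^ length ys * fact (length ys)) * prod_list (map (\<lambda>y. mvar (y, k)) ys)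
    \<in> graded_sum I (UNIV \<times> - K) (length ys)"
proof (induction "length ys" arbitrary: ys)
  case 0
  then show ?case by (simp add: mconst_1 graded_sum_0[OF I])
next
  case (Suc l)
  let ?u = "\<lambda>ys. prod_list (map (\<lambda>y. mvar (y, k)) ys) :: ('m \<times> 'n, 'k) mpoly"
  let ?J = "graded_sum I (UNIV \<times> - K)"
  let ?c = "mconst ((-1) ^ l * fact l) :: ('m \<times> 'n, 'k) mpoly"
  let ?R = "\<lambda>i. polarized_esym (remove_nth i ys) (K - {k}) - ?c * ?u (remove_nth i ys)"
  have K: "polarized_esym ys K \<in> ?J (Suc l)"
  proof -
    have "(polarized_esym ys K - polarized_esym ys UNIV :: ('m \<times> 'n, 'k) mpoly) = mconst (-1) * (polarized_esym ys UNIV - polarized_esym ys K)"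
      by (simp add: mconst_uminus mconst_1)
    then have "(polarized_esym ys K - polarized_esym ys UNIV :: ('m \<times> 'n, 'k) mpoly) \<in> touching (UNIV \<times> - K) (Suc l)"
      using touching_mconst_mult[OF polarized_esym_superset[of K UNIV ys], of "-1"] Suc.hyps
      by (simp add: Compl_eq_Diff_UNIV)
    moreover have "polarized_esym ys UNIV \<in> I" using Suc.hyps(2) by (intro E) auto
    ultimately show ?thesis
      using graded_sumI[OF I, of "polarized_esym ys UNIV" "polarized_esym ys K - polarized_esym ys UNIV"]
      by simp
  qed
  have R: "?R i \<in> ?J l" if "i < Suc l" for i
  proof -
    have l: "l = length (remove_nth i ys)"
      using Suc.hyps(2) that by (simp add: remove_nth_def)
    show ?thesis using Suc.hyps(1)[OF l] unfolding l[symmetric] .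
  qed
  have "(polarized_esym ys K :: ('m \<times> 'n, 'k) mpoly) = polarized_esym ys (K - {k}) +
      (\<Sum>i<Suc l. mvar (ys ! i, k) * polarized_esym (remove_nth i ys) (K - {k}))"
    using polarized_esym_insert[of "K - {k}" k ys] k Suc.hyps(2) by (simp add: insert_absorb)
  also have "(\<Sum>i<Suc l. mvar (ys ! i, k) * polarized_esym (remove_nth i ys) (K - {k})) =
      (\<Sum>i<Suc l. mvar (ys ! i, k) * ?R i + ?c * ?u ys)"
    using Suc.hyps(2) prod_list_remove_nth[of _ ys "\<lambda>y. mvar (y, k) :: ('m \<times> 'n, 'k) mpoly"]
    by (intro sum.cong refl) (simp add: right_diff_distrib mult.left_commute[of _ ?c])
  also have "\<dots> = (\<Sum>i<Suc l. mvar (ys ! i, k) * ?R i) + of_nat (Suc l) * ?c * ?u ys"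
    unfolding sum.distrib by (simp add: algebra_simps)
  also have "of_nat (Suc l) = (mconst (of_nat (Suc l)) :: ('m \<times> 'n, 'k) mpoly)"
    by (simp add: mconst_def del: of_nat_Suc)
  also have "mconst (of_nat (Suc l)) * ?c = - mconst ((-1) ^ Suc l * fact (Suc l))"
    unfolding mconst_mult[symmetric] by (simp add: mconst_uminus[symmetric] algebra_simps)
  finally have eq: "polarized_esym ys (K - {k}) - mconst ((-1) ^ Suc l * fact (Suc l)) * ?u ys =
      polarized_esym ys K - (\<Sum>i<Suc l. mvar (ys ! i, k) * ?R i)"
    by (simp only: algebra_simps) simp
  have "(\<Sum>i<Suc l. mvar (ys ! i, k) * ?R i) \<in> ?J (Suc l)"
    by (intro graded_sum_sum[OF I] graded_sum_mvar_mult[OF I] R) auto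
  then show ?case
    unfolding Suc.hyps(2)[symmetric] eq by (rule graded_sum_diff[OF I K])
qed

text \<open>
  With as many indices as points in \<open>K\<close>, there is no injection into \<open>K - {k}\<close>, so the left-hand
  sum in \<open>polarized_esym_congruence\<close> is zero.  Dividing by the factorial is where characteristic
  zero enters.
\<close>

lemma power_at_point:
  fixes I :: "('m::finite \<times> 'n::finite, 'k::field_char_0) mpoly set"
  assumes I: "ideal I ring_of_type_algebra"
    and E: "\<And>ys. ys \<noteq> [] \<Longrightarrow> polarized_esym ys UNIV \<in> I"
    and k: "k \<in> K" and ys: "length ys = card K"
  shows "prod_list (map (\<lambda>y. mvar (y, k)) ys) \<in> graded_sum I (UNIV \<times> - K) (length ys)"
proof -
  let ?u = "prod_list (map (\<lambda>y. mvar (y, k)) ys) :: ('m \<times> 'n, 'k) mpoly"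
  define c where "c = ((-1) ^ length ys * fact (length ys) :: 'k)"
  have "c \<noteq> 0" by (simp add: c_def)
  have "polarized_esym ys (K - {k}) = (0 :: ('m \<times> 'n, 'k) mpoly)"
    using k ys card_Diff1_less[of K k] by (intro polarized_esym_eq_0) auto
  with polarized_esym_congruence[OF I E k, of ys] have "- (mconst c * ?u) \<in> graded_sum I (UNIV \<times> - K) (length ys)"
    by (simp add: c_def)
  from graded_sum_mconst_mult[OF I this, of "- inverse c"]
  have "mconst (inverse c * c) * ?u \<in> graded_sum I (UNIV \<times> - K) (length ys)"
    by (simp only: mconst_mult mconst_uminus mult.assoc minus_mult_minus)
  then show ?thesis using \<open>c \<noteq> 0\<close> by (simp add: mconst_1)
qed

section \<open>Monomials of large degree\<close>

definition weight :: "('i \<Rightarrow> nat) \<Rightarrow> ('i::finite \<Rightarrow>\<^sub>0 nat) \<Rightarrow> nat" where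
  "weight w a = (\<Sum>i\<in>UNIV. Poly_Mapping.lookup a i * w i)"

lemma weight_add: "weight w (a + b) = weight w a + weight w b"
  by (simp add: weight_def lookup_add sum.distrib algebra_simps)

lemma weight_single: "weight w (Poly_Mapping.single i c) = c * w i"
proof -
  have "weight w (Poly_Mapping.single i c) = (\<Sum>j\<in>UNIV. if j = i then c * w i else 0)"
    unfolding weight_def by (rule sum.cong) (auto simp: lookup_single when_def)
  then show ?thesis by simp
qed

lemma weight_mono:
  "(\<And>i. w i \<le> C) \<Longrightarrow> weight w a \<le> mdegree a * C"
  by (simp add: weight_def mdegree_def sum_distrib_right sum_mono)

lemma weight_ge:
  assumes "i \<in> Poly_Mapping.keys a" shows "w i \<le> weight w a"
proof -
  have "w i \<le> Poly_Mapping.lookup a i * w i"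
    using assms by (simp add: in_keys_iff)
  also have "\<dots> \<le> weight w a"
    unfolding weight_def by (rule member_le_sum) auto
  finally show ?thesis .
qed

definition point_exponent :: "'n \<Rightarrow> 'm list \<Rightarrow> ('m \<times> 'n \<Rightarrow>\<^sub>0 nat)" where
  "point_exponent k ys = sum_list (map (\<lambda>y. Poly_Mapping.single (y, k) 1) ys)"

lemma prod_list_mvar:
  "prod_list (map (\<lambda>y. mvar (y, k)) ys) = Poly_Mapping.single (point_exponent k ys) 1"
  by (induction ys) (simp_all add: point_exponent_def mvar_def mult_single)

lemma mdegree_point_exponent: "mdegree (point_exponent k ys) = length ys"
  by (induction ys) (simp_all add: point_exponent_def mdegree_add mdegree_single, simp add: mdegree_def)

lemma weight_point_exponent: "weight (\<lambda>p. w (snd p)) (point_exponent k ys) = length ys * w k"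
  by (induction ys) (simp_all add: point_exponent_def weight_add weight_single, simp add: weight_def)

lemma split_off_point_exponent:
  fixes a :: "('m::finite \<times> 'n::finite) \<Rightarrow>\<^sub>0 nat"
  assumes "N \<le> (\<Sum>j\<in>UNIV. Poly_Mapping.lookup a (j, k))"
  obtains c ys where "length ys = N" "a = c + point_exponent k ys"
  using assms
proof (induction N arbitrary: a thesis)
  case 0
  from 0(1)[of "[]" a] show ?case by (simp add: point_exponent_def)
next
  case (Suc N)
  then obtain j where "Poly_Mapping.lookup a (j, k) \<noteq> 0"
    by (metis (mono_tags, lifting) not_less_eq_eq le0 sum.neutral)
  define b where "b = a - Poly_Mapping.single (j, k) 1"
  have a: "a = b + Poly_Mapping.single (j, k) 1"
    using \<open>Poly_Mapping.lookup a (j, k) \<noteq> 0\<close> unfolding b_def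
    by (intro poly_mapping_eqI) (auto simp: lookup_add lookup_minus lookup_single when_def)
  have "(\<Sum>i\<in>UNIV. Poly_Mapping.lookup a (i, k)) =
      (\<Sum>i\<in>UNIV. Poly_Mapping.lookup b (i, k)) + (\<Sum>i\<in>UNIV. if i = j then 1 else 0)"
    unfolding a sum.distrib[symmetric] by (rule sum.cong) (auto simp: lookup_add lookup_single when_def)
  then have "N \<le> (\<Sum>i\<in>UNIV. Poly_Mapping.lookup b (i, k))"
    using Suc.prems(2) by simp
  then obtain c ys where "length ys = N" "b = c + point_exponent k ys"
    using Suc.IH by blast
  then show ?case
    using Suc.prems(1)[of "j # ys" c] a by (simp add: point_exponent_def add_ac)
qed

lemma ideal_monomials:
  fixes I :: "('i, 'k::comm_ring_1) mpoly set"
  assumes I: "ideal I ring_of_type_algebra"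
    and "\<And>a. a \<in> Poly_Mapping.keys f \<Longrightarrow> Poly_Mapping.single a 1 \<in> I"
  shows "f \<in> I"
proof -
  have "Poly_Mapping.single a c \<in> I" if "a \<in> Poly_Mapping.keys f" for a c
    using ideal_mult[OF I assms(2)[OF that], of "mconst c"] by (simp add: mconst_def mult_single)
  then show ?thesis
    by (subst mpoly_eq_sum_single[of f]) (intro ideal_sum[OF I])
qed

text \<open>
  Rewriting by \<open>power_at_point\<close> moves at least one variable to a point with a smaller number, but may
  move the others to larger numbers.  Weights that grow by the factor \<open>CARD('n) + 1\<close> from
  each point to the preceding one still increase, as at most \<open>CARD('n)\<close> variables are
  replaced.  In a fixed degree the weight is bounded, which makes the induction well-founded.
\<close>

lemma monomial_in_ideal:
  fixes I :: "('m::finite \<times> 'n::finite, 'k::field_char_0) mpoly set"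
  assumes I: "ideal I ring_of_type_algebra"
    and E: "\<And>ys. ys \<noteq> [] \<Longrightarrow> polarized_esym ys UNIV \<in> I"
    and a: "mdegree a > CARD('n) choose 2"
  shows "Poly_Mapping.single a 1 \<in> I"
proof -
  let ?n = "CARD('n)"
  obtain h :: "'n \<Rightarrow> nat" where h: "bij_betw h UNIV {0..<?n}"
    using ex_bij_betw_finite_nat[of "UNIV :: 'n set"] by auto
  have h_less: "h p < ?n" for p
    using h by (auto dest: bij_betwE)
  define w where "w p = (?n + 1) ^ (?n - 1 - h p)" for p :: 'n
  let ?wt = "weight (\<lambda>p. w (snd p)) :: ('m \<times> 'n \<Rightarrow>\<^sub>0 nat) \<Rightarrow> nat"
  define C where "C = (?n + 1) ^ ?n"
  have w_le: "w p \<le> C" for p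
    unfolding w_def C_def by (rule power_increasing) auto
  have w_less: "?n * w k < w p" if "h p < h k" for p k
  proof -
    have "?n * w k < (?n + 1) ^ Suc (?n - 1 - h k)"
      by (simp add: w_def)
    also have "\<dots> \<le> w p"
      unfolding w_def using that h_less[of k] by (intro power_increasing) auto
    finally show ?thesis .
  qed
  show ?thesis
    using a
  proof (induction "mdegree a * C - ?wt a" arbitrary: a rule: less_induct)
    case less
    \<comment> \<open>Otherwise the degree is at most the sum of the numbers \<open>n - 1 - i\<close>, which is \<open>n choose 2\<close>.\<close>
    have "\<exists>k. ?n - h k \<le> (\<Sum>j\<in>UNIV. Poly_Mapping.lookup a (j, k))"
    proof (rule ccontr)
      assume "\<not> ?thesis"
      then have *: "(\<Sum>j\<in>UNIV. Poly_Mapping.lookup a (j, k)) \<le> ?n - Suc (h k)" for k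
        by (metis Suc_diff_Suc h_less less_Suc_eq_le not_le)
      have "mdegree a = (\<Sum>k\<in>UNIV. \<Sum>j\<in>UNIV. Poly_Mapping.lookup a (j, k))"
        unfolding mdegree_def
        by (subst sum.swap) (simp add: sum.cartesian_product UNIV_Times_UNIV)
      also have "\<dots> \<le> (\<Sum>k\<in>UNIV. ?n - Suc (h k))"
        using * by (rule sum_mono)
      also have "\<dots> = (\<Sum>i<?n. ?n - Suc i)"
        using sum.reindex_bij_betw[OF h, of "\<lambda>i. ?n - Suc i"] by (simp add: atLeast0LessThan)
      also have "\<dots> = (\<Sum>i<?n. i)"
        by (rule sum.nat_diff_reindex)
      also have "\<dots> = ?n choose 2"
        by (simp add: Sum_Ico_nat choose_two atLeast0LessThan[symmetric])
      finally show False using less.prems by simp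
    qed
    then obtain k where "?n - h k \<le> (\<Sum>j\<in>UNIV. Poly_Mapping.lookup a (j, k))" ..
    then obtain c ys where ys: "length ys = ?n - h k" and a: "a = c + point_exponent k ys"
      by (rule split_off_point_exponent)
    define K where "K = {p. h k \<le> h p}"
    have "h ` K = {h k..<?n}"
      using h by (fastforce simp: K_def bij_betw_def)
    then have "card K = ?n - h k"
      using h by (metis bij_betw_imp_inj_on card_atLeastLessThan card_image inj_on_subset subset_UNIV)
    with ys have "length ys = card K" by simp
    moreover have "k \<in> K" by (simp add: K_def)
    ultimately obtain f g where fg: "Poly_Mapping.single (point_exponent k ys) 1 = f + g" "f \<in> I"
      and g: "g \<in> touching (UNIV \<times> - K) (length ys)"
      using power_at_point[OF I E, of k K ys] by (auto simp: prod_list_mvar graded_sum_def)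
    have "Poly_Mapping.single c 1 * g \<in> I"
    proof (rule ideal_monomials[OF I])
      fix x assume "x \<in> Poly_Mapping.keys (Poly_Mapping.single c (1::'k) * g)"
      then obtain b where x: "x = c + b" and "b \<in> Poly_Mapping.keys g"
        using keys_mult[of "Poly_Mapping.single c (1::'k)" g] by auto
      then have deg: "mdegree b = length ys" and "Poly_Mapping.keys b \<inter> UNIV \<times> - K \<noteq> {}"
        using g by (auto simp: touching_def homogeneous_def)
      then obtain j p where p: "(j, p) \<in> Poly_Mapping.keys b" "p \<notin> K" by blast
      have "?wt (point_exponent k ys) \<le> ?n * w k"
        by (simp add: weight_point_exponent ys)
      also have "\<dots> < w p" using p(2) by (intro w_less) (simp add: K_def)
      also have "\<dots> \<le> ?wt b" using weight_ge[OF p(1), of "\<lambda>p. w (snd p)"] by simp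
      finally have "?wt a < ?wt x" by (simp add: a x weight_add)
      moreover have "mdegree x = mdegree a"
        by (simp add: a x mdegree_add deg mdegree_point_exponent)
      moreover have "?wt x \<le> mdegree x * C"
        by (rule weight_mono) (rule w_le)
      ultimately show "Poly_Mapping.single x 1 \<in> I"
        using less.prems by (intro less.hyps) auto
    qed
    then have "Poly_Mapping.single c 1 * f + Poly_Mapping.single c 1 * g \<in> I"
      using ideal_add[OF I] ideal_mult[OF I] fg(2) by blast
    also have "Poly_Mapping.single c 1 * f + Poly_Mapping.single c 1 * g = Poly_Mapping.single a 1"
      unfolding distrib_left[symmetric] fg(1)[symmetric] by (simp add: a mult_single)
    finally show ?case .
  qed
qed

section \<open>The top degree of the coinvariants\<close>

lemma ideal_hilbert_ideal: "ideal (hilbert_ideal G \<rho>) ring_of_type_algebra"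
  unfolding hilbert_ideal_def
  by (intro ring.genideal_ideal ring_from_type_algebra) (simp add: ring_of_type_algebra_def)

lemma hilbert_ideal_self:
  assumes "f \<in> invariants G \<rho>" "f \<in> homogeneous d" "d > 0"
  shows "f \<in> hilbert_ideal G \<rho>"
  unfolding hilbert_ideal_def
  by (rule subsetD[OF ring.genideal_self[OF ring_from_type_algebra]])
    (use assms in \<open>auto simp: ring_of_type_algebra_def Suc_le_eq\<close>)

text \<open>
  Evaluation at the origin kills the Hilbert ideal.  So the coinvariants are non-zero in degree
  \<open>0\<close>, and the maximum in the definition of the top degree is over a non-empty set.
\<close>

lemma one_notin_hilbert_ideal:
  fixes \<rho> :: "'g \<Rightarrow> 'k::field ^ 'i::finite \<Rightarrow> 'k ^ 'i"
  shows "1 \<notin> hilbert_ideal G \<rho>"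
proof -
  let ?R = "ring_of_type_algebra :: ('i, 'k) mpoly ring"
  let ?M = "{f :: ('i, 'k) mpoly. meval f 0 = 0}"
  interpret R: ring ?R by (rule ring_from_type_algebra)
  have "ideal ?M ?R"
  proof (rule idealI)
    show "subgroup ?M (add_monoid ?R)"
    proof (rule R.add.subgroupI)
      fix f assume f: "f \<in> ?M"
      have "\<ominus>\<^bsub>?R\<^esub> f = - f"
        by (rule R.minus_equality) (auto simp: ring_of_type_algebra_def)
      moreover have "meval (- f) 0 = - meval f 0"
        using meval_add[of f "- f" 0] by (simp add: meval_zero add_eq_0_iff)
      ultimately show "\<ominus>\<^bsub>?R\<^esub> f \<in> ?M" using f by simp
    qed (auto simp: ring_of_type_algebra_def meval_zero meval_add intro: exI[of _ 0])
  qed (auto simp: ring_of_type_algebra_def meval_mult intro: ring_from_type_algebra[unfolded ring_of_type_algebra_def])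
  moreover have "invariants G \<rho> \<inter> homogeneous d \<subseteq> ?M" if "d \<in> {1..}" for d
  proof
    fix f assume "f \<in> invariants G \<rho> \<inter> homogeneous d"
    then have f: "f \<in> homogeneous d" by simp
    have "(\<Prod>i\<in>UNIV. (0 :: 'k) ^ Poly_Mapping.lookup a i) = 0" if "a \<in> Poly_Mapping.keys f" for a
    proof -
      have "mdegree a \<noteq> 0" using f that \<open>d \<in> {1..}\<close> by (auto simp: homogeneous_def)
      then obtain i where "Poly_Mapping.lookup a i \<noteq> 0" unfolding mdegree_def by (meson sum.neutral)
      then show ?thesis by (auto simp: prod_zero_iff)
    qed
    then have "meval f 0 = 0"
      unfolding meval_def msubst_def by (intro sum.neutral ballI) (simp only: zero_index mult_zero_right)
    then show "f \<in> ?M" by simp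
  qed
  ultimately have "hilbert_ideal G \<rho> \<subseteq> ?M"
    unfolding hilbert_ideal_def by (intro R.genideal_minimal UN_least)
  moreover have "1 \<notin> ?M" by (simp add: meval_one)
  ultimately show ?thesis by blast
qed

lemma coinvariants_component_zero_iff:
  fixes \<rho> :: "'g \<Rightarrow> 'k::field ^ 'i::finite \<Rightarrow> 'k ^ 'i"
  shows "coinvariants_component G \<rho> d = {\<zero>\<^bsub>coinvariants G \<rho>\<^esub>} \<longleftrightarrow> homogeneous d \<subseteq> hilbert_ideal G \<rho>"
proof -
  let ?R = "ring_of_type_algebra :: ('i, 'k) mpoly ring"
  let ?I = "hilbert_ideal G \<rho>"
  interpret ideal ?I ?R by (rule ideal_hilbert_ideal)
  have "(?I +>\<^bsub>?R\<^esub> f = ?I) \<longleftrightarrow> f \<in> ?I" for f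
    using a_rcos_const[of f] rcos_const_imp_mem[of f] by (auto simp: ring_of_type_algebra_def)
  moreover have "(0 :: ('i, 'k) mpoly) \<in> homogeneous d" by (simp add: homogeneous_def)
  ultimately show ?thesis
    by (auto simp: coinvariants_component_def coinvariants_def FactRing_def image_subset_iff
        set_eq_iff[of "_ ` _"])
qed

theorem mainTheorem2:
  fixes G :: "('n::finite \<Rightarrow> 'n) set"
  assumes "subgroup G (BijGroup UNIV)"
  shows "coinvariants_top_degree G
           (diagonal_action perm_action ::
              ('n \<Rightarrow> 'n) \<Rightarrow> 'k::field_char_0 ^ ('m::finite \<times> 'n) \<Rightarrow> 'k ^ ('m \<times> 'n))
         \<le> CARD('n) choose 2"
proof -
  let ?\<rho> = "diagonal_action perm_action ::
              ('n \<Rightarrow> 'n) \<Rightarrow> 'k ^ ('m \<times> 'n) \<Rightarrow> 'k ^ ('m \<times> 'n)"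
  let ?I = "hilbert_ideal G ?\<rho>"
  have I: "ideal ?I ring_of_type_algebra" by (rule ideal_hilbert_ideal)
  have bij: "bij g" if "g \<in> G" for g
    using subgroup.subset[OF assms] that by (auto simp: BijGroup_def Bij_def)
  have E: "polarized_esym ys UNIV \<in> ?I" if "ys \<noteq> []" for ys
  proof (rule hilbert_ideal_self)
    show "polarized_esym ys UNIV \<in> invariants G ?\<rho>"
      by (auto simp: invariants_def poly_action_diagonal_perm_action bij msubst_polarized_esym bij_is_inj
          bij_is_surj)
  qed (use that in \<open>auto intro: homogeneous_polarized_esym\<close>)
  let ?D = "{d. coinvariants_component G ?\<rho> d \<noteq> {\<zero>\<^bsub>coinvariants G ?\<rho>\<^esub>}}"
  have bound: "?D \<subseteq> {..CARD('n) choose 2}"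
  proof
    fix d assume d: "d \<in> ?D"
    have "homogeneous d \<subseteq> ?I" if d: "d > CARD('n) choose 2"
    proof
      fix f :: "('m \<times> 'n, 'k) mpoly" assume f: "f \<in> homogeneous d"
      show "f \<in> ?I"
      proof (rule ideal_monomials[OF I])
        fix a assume "a \<in> Poly_Mapping.keys f"
        with f d have "mdegree a > CARD('n) choose 2" by (simp add: homogeneous_def)
        then show "Poly_Mapping.single a 1 \<in> ?I" by (intro monomial_in_ideal[OF I] E)
      qed
    qed
    with d show "d \<in> {..CARD('n) choose 2}"
      by (auto simp: coinvariants_component_zero_iff not_less[symmetric])
  qed
  have "1 \<in> (homogeneous 0 :: ('m \<times> 'n, 'k) mpoly set)"
    by (simp add: homogeneous_def mdegree_def)
  then have "0 \<in> ?D"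
    using one_notin_hilbert_ideal[of G ?\<rho>] by (auto simp: coinvariants_component_zero_iff)
  then show ?thesis
    unfolding coinvariants_top_degree_def
    using bound finite_subset[OF bound] by (subst Max_le_iff) auto
qed

end
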